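(* Let $A=(A,+)$ be an abelian group, $H$ a non-empty set and $\phi:H\times A\to H$ a map. (1) Let $(A,H,\phi;+,\{\cdot_\lambda\}_{\lambda\in H})$ be a dynamical brace. Put $\mathfrak{L}^\lambda_a:=\gamma_\lambda(a):A\to A$, where $\gamma_\lambda(a)(c)=c\cdot_\lambda a+c$. Then $\{\mathfrak{L}^\lambda_a\}_{(\lambda,a)\in H\times A}$ is a family of automorphisms of the abelian group $(A,+)$ satisfying $\mathfrak{L}^\lambda_a\circ\mathfrak{L}^{\phi(\lambda,a)}_b=\mathfrak{L}^\lambda_{\mathfrak{L}^\lambda_a(b)+a}$ for all $(\lambda,a,b)\in H\times A\times A$. (2) Let $\{\mathfrak{L}^\lambda_a:A\to A\}_{(\lambda,a)\in H\times A}$ be a family of automorphisms of the abelian group $(A,+)$ satisfying $\mathfrak{L}^\lambda_a\circ\mathfrak{L}^{\phi(\lambda,a)}_b=\mathfrak{L}^\lambda_{\mathfrak{L}^\lambda_a(b)+a}$ for all $(\lambda,a,b)\in H\times A\times A$. Define multiplications on $A$ by $a\cdot_\lambda b:=\mathfrak{L}^\lambda_b(a)-a$. Then $(A,H,\phi;+,\{\cdot_\lambda\}_{\lambda\in H})$ is a dynamical brace. (3) The correspondence given by (1) and (2), between dynamical braces $(A,H,\phi;+,\{\cdot_\lambda\}_{\lambda\in H})$ and families $\{\mathfrak{L}^\lambda_a\}_{(\lambda,a)\in H\times A}$ of automorphisms of $(A,+)$ satisfying $\mathfrak{L}^\lambda_a\circ\mathfrak{L}^{\phi(\lambda,a)}_b=\mathfrak{L}^\lambda_{\mathfrak{L}^\lambda_a(b)+a}$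 for all $(\lambda,a,b)\in H\times A\times A$, is one-to-one.
   Context: Let $H$ be a non-empty set, $(A,+)$ an abelian group with a family of multiplications (binary operations, not assumed associative) $\{\cdot_\lambda:A\times A\to A\}_{\lambda\in H}$, and $\phi:H\times A\to H$ a map. $(A,H,\phi;+,\{\cdot_\lambda\}_{\lambda\in H})$ is called a dynamical brace (d-brace) if for all $(\lambda,a,b,c)\in H\times A\times A\times A$: 1. $(a+b)\cdot_\lambda c=a\cdot_\lambda c+b\cdot_\lambda c$; 2. $a\cdot_\lambda(b\cdot_\lambda c+b+c)=(a\cdot_{\phi(\lambda,c)}b)\cdot_\lambda c+a\cdot_{\phi(\lambda,c)}b+a\cdot_\lambda c$; 3. the map $\gamma_\lambda(b):A\to A$, $a\mapsto a\cdot_\lambda b+a$, is bijective. *)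

theory Defs
  imports Complex_Main
begin

text \<open>
  The abelian group \<open>(A,+)\<close> is the type \<open>'a::ab_group_add\<close> and the non-empty set \<open>H\<close> is the
  type \<open>'h\<close>. The map \<open>\<phi>\<close> is curried, and \<open>mult \<lambda> a b\<close> stands for the product of \<open>a\<close> and \<open>b\<close>
  with respect to \<open>\<lambda>\<close>.
\<close>

definition gamma :: "('h \<Rightarrow> 'a \<Rightarrow> 'a \<Rightarrow> 'a) \<Rightarrow> 'h \<Rightarrow> 'a \<Rightarrow> 'a \<Rightarrow> 'a::ab_group_add" where
  "gamma mult l b = (\<lambda>a. mult l a b + a)"

locale dynamical_brace =
  fixes \<phi> :: "'h \<Rightarrow> 'a::ab_group_add \<Rightarrow> 'h"
    and mult :: "'h \<Rightarrow> 'a \<Rightarrow> 'a \<Rightarrow> 'a"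
  assumes mult_add_left: "mult l (a + b) c = mult l a c + mult l b c"
    and mult_brace:
      "mult l a (mult l b c + b + c) =
        mult l (mult (\<phi> l c) a b) c + mult (\<phi> l c) a b + mult l a c"
    and bij_gamma: "bij (gamma mult l b)"

definition add_automorphism :: "('a::ab_group_add \<Rightarrow> 'a) \<Rightarrow> bool" where
  "add_automorphism f \<longleftrightarrow> additive f \<and> bij f"

locale automorphism_family =
  fixes \<phi> :: "'h \<Rightarrow> 'a::ab_group_add \<Rightarrow> 'h"
    and L :: "'h \<Rightarrow> 'a \<Rightarrow> 'a \<Rightarrow> 'a"
  assumes automorphism: "add_automorphism (L l a)"
    and comp_law: "L l a \<circ> L (\<phi> l a) b = L l (L l a b + a)"

definition mult_of_family :: "('h \<Rightarrow> 'a \<Rightarrow> 'a \<Rightarrow> 'a) \<Rightarrow> 'h \<Rightarrow> 'a \<Rightarrow> 'a \<Rightarrow> 'a::ab_group_add" where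
  "mult_of_family L l a b = L l b a - a"

end

theory Submission
  imports Defs
begin

text \<open>Adding and subtracting the left factor are inverse to each other, so
  \<open>gamma\<close> and \<open>mult_of_family\<close> are mutually inverse translations between
  multiplications and families of maps. It remains to match the axioms under L =
  \<open>gamma mult\<close>: distributivity on the left factor is additivity of each map, the
  bijectivity axioms coincide, and, given additivity, the brace identity is the composition law
  evaluated at the leftmost factor, with that factor subtracted from both sides.
  \<open>automorphism_family_gamma\<close> and \<open>dynamical_brace_mult_of_family\<close> carry
  out this matching in the two directions.\<close>

lemma mult_of_family_gamma: "mult_of_family (gamma mult) = mult"
  by (simp add: fun_eq_iff mult_of_family_def gamma_def)

lemma gamma_mult_of_family: "gamma (mult_of_family L) = L"
  by (simp add: fun_eq_iff mult_of_family_def gamma_def)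

lemma automorphism_family_gamma:
  assumes "dynamical_brace \<phi> mult"
  shows "automorphism_family \<phi> (gamma mult)"
proof -
  interpret dynamical_brace \<phi> mult by fact
  show ?thesis
  proof
    show "add_automorphism (gamma mult l a)" for l a
      using bij_gamma by (auto simp: add_automorphism_def additive_def gamma_def mult_add_left algebra_simps)
    show "gamma mult l a \<circ> gamma mult (\<phi> l a) b = gamma mult l (gamma mult l a b + a)" for l a b
    proof
      fix c
      \<comment> \<open>Distributivity splits the outer product on the left; what results is the
        brace identity with leftmost factor \<open>c\<close> and rightmost factor \<open>a\<close>,
        plus \<open>c\<close> on both sides.\<close>
      show "(gamma mult l a \<circ> gamma mult (\<phi> l a) b) c = gamma mult l (gamma mult l a b + a) c"
        using mult_brace[of l c b a] by (simp add: gamma_def mult_add_left algebra_simps)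
    qed
  qed
qed

lemma dynamical_brace_mult_of_family:
  assumes "automorphism_family \<phi> L"
  shows "dynamical_brace \<phi> (mult_of_family L)"
proof -
  interpret automorphism_family \<phi> L by fact
  have additive: "additive (L l a)" for l a
    using automorphism by (simp add: add_automorphism_def)
  note add = additive.add[OF additive] and diff = additive.diff[OF additive]
  show ?thesis
  proof
    show "mult_of_family L l (a + b) c = mult_of_family L l a c + mult_of_family L l b c" for l a b c
      by (simp add: mult_of_family_def add)
    show "mult_of_family L l a (mult_of_family L l b c + b + c) =
        mult_of_family L l (mult_of_family L (\<phi> l c) a b) c + mult_of_family L (\<phi> l c) a b
        + mult_of_family L l a c" for l a b c
      \<comment> \<open>The inner argument \<open>mult_of_family L l b c + b + c\<close> collapses
        to \<open>L l c b + c\<close>, the index in the composition law. On the right,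
        \<open>diff\<close> splits \<open>L l c (L (\<phi> l c) b a - a)\<close>, and the terms
        \<open>L l c a\<close> cancel.\<close>
      using fun_cong[OF comp_law[of l c b], of a] by (simp add: mult_of_family_def diff)
    show "bij (gamma (mult_of_family L) l b)" for l b
      using automorphism by (simp add: gamma_mult_of_family add_automorphism_def)
  qed
qed

theorem theorem3p2:
  fixes \<phi> :: "'h \<Rightarrow> 'a::ab_group_add \<Rightarrow> 'h"
  shows "(\<forall>mult. dynamical_brace \<phi> mult \<longrightarrow> automorphism_family \<phi> (gamma mult))
    \<and> (\<forall>L. automorphism_family \<phi> L \<longrightarrow> dynamical_brace \<phi> (mult_of_family L))
    \<and> bij_betw gamma {mult. dynamical_brace \<phi> mult} {L. automorphism_family \<phi> L}
    \<and> bij_betw mult_of_family {L. automorphism_family \<phi> L} {mult. dynamical_brace \<phi> mult}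
    \<and> (\<forall>mult. dynamical_brace \<phi> mult \<longrightarrow> mult_of_family (gamma mult) = mult)
    \<and> (\<forall>L. automorphism_family \<phi> L \<longrightarrow> gamma (mult_of_family L) = L)"
proof (intro conjI)
  show "bij_betw gamma {mult. dynamical_brace \<phi> mult} {L. automorphism_family \<phi> L}"
    \<comment> \<open>The cancellation identities make \<open>mult_of_family\<close> a two-sided
      inverse; the two transfer lemmas show that each map lands in the other set.\<close>
    by (rule bij_betw_byWitness[where f' = mult_of_family])
      (auto simp: mult_of_family_gamma gamma_mult_of_family
        intro: automorphism_family_gamma dynamical_brace_mult_of_family)
  show "bij_betw mult_of_family {L. automorphism_family \<phi> L} {mult. dynamical_brace \<phi> mult}"
    by (rule bij_betw_byWitness[where f' = gamma])
      (auto simp: mult_of_family_gamma gamma_mult_of_family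
        intro: automorphism_family_gamma dynamical_brace_mult_of_family)
qed (simp_all add: automorphism_family_gamma dynamical_brace_mult_of_family
    mult_of_family_gamma gamma_mult_of_family)

end
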